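(* Let $(w,ww',w')$ be a triple of Christoffel $ab$-words and let $(f_w(t),f_{ww'}(t),f_{w'}(t))$ be the corresponding triple of castling Markov polynomials. Then $(x,y,z)=(f_w(t),f_{ww'}(t),f_{w'}(t))$ is a solution of the modified Markov equation $$x^2+y^2+z^2+(t-3)=t\,xyz .$$
   Context: Triples of Christoffel $ab$-words are the triples of words in the letters $a,b$ generated as follows: $(a,ab,b)$ is such a triple, and whenever $(w,ww',w')$ is such a triple (where $ww'$ is the concatenation of $w$ and $w'$), so are $(w,\,www',\,ww')$ and $(ww',\,ww'w',\,w')$; all triples arise this way. The castling Markov polynomials $f_w(t)\in\mathbb{Z}[t]$, indexed by the Christoffel words $w$ occurring in these triples, are defined recursively along this tree by $$f_a(t)=1,\qquad f_{ab}(t)=t^2-t-1,\qquad f_b(t)=t-1,$$ and, for each triple $(w,ww',w')$, $$f_{www'}(t)=t\,f_w(t)f_{ww'}(t)-f_{w'}(t),\qquad f_{ww'w'}(t)=t\,f_{ww'}(t)f_{w'}(t)-f_w(t).$$ *)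

theory Defs
  imports "HOL-Computational_Algebra.Polynomial"
begin

datatype letter = A | B

type_synonym word = "letter list"

inductive christoffel_triple :: "word \<Rightarrow> word \<Rightarrow> word \<Rightarrow> bool" where
  base: "christoffel_triple [A] [A, B] [B]"
| left: "christoffel_triple w (w @ w') w' \<Longrightarrow> christoffel_triple w (w @ w @ w') (w @ w')"
| right: "christoffel_triple w (w @ w') w' \<Longrightarrow> christoffel_triple (w @ w') (w @ w' @ w') w'"

abbreviation t :: "int poly" where
  "t \<equiv> [:0, 1:]"

text \<open>
  The graph of the recursion for the castling Markov polynomials: \<open>castling w p\<close>
  means that the recursion assigns the polynomial \<open>p\<close> to the word \<open>w\<close>. That this is a
  function on the words occurring in Christoffel triples is shown by
  \<open>castling_unique\<close> and \<open>castling_exists\<close> below.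
\<close>

inductive castling :: "word \<Rightarrow> int poly \<Rightarrow> bool" where
  "castling [A] 1"
| "castling [A, B] (t ^ 2 - t - 1)"
| "castling [B] (t - 1)"
| "\<lbrakk>christoffel_triple w (w @ w') w';
    castling w p; castling (w @ w') q; castling w' r\<rbrakk>
   \<Longrightarrow> castling (w @ w @ w') (t * p * q - r)"
| "\<lbrakk>christoffel_triple w (w @ w') w';
    castling w p; castling (w @ w') q; castling w' r\<rbrakk>
   \<Longrightarrow> castling (w @ w' @ w') (t * q * r - p)"

definition castling_poly :: "word \<Rightarrow> int poly" where
  "castling_poly w = (THE p. castling w p)"

lemma christoffel_triple_middle:
  assumes "christoffel_triple u m v"
  shows "m = u @ v"
  using assms by (induction rule: christoffel_triple.induct) auto

lemma christoffel_triple_nonempty: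
  assumes "christoffel_triple u m v"
  shows "u \<noteq> [] \<and> v \<noteq> []"
  using assms by (induction rule: christoffel_triple.induct) auto

definition cnt :: "letter \<Rightarrow> word \<Rightarrow> int" where
  "cnt x w = int (length (filter ((=) x) w))"

lemma cnt_simps [simp]:
  "cnt x [] = 0"
  "cnt x (y # w) = (if x = y then 1 else 0) + cnt x w"
  "cnt x (u @ v) = cnt x u + cnt x v"
  by (auto simp: cnt_def)

lemma cnt_nonneg: "cnt x w \<ge> 0"
  by (simp add: cnt_def)

lemma cnt_length: "cnt A w + cnt B w = int (length w)"
proof (induction w)
  case (Cons x w)
  then show ?case by (cases x) auto
qed simp

lemma christoffel_triple_det:
  assumes "christoffel_triple u m v"
  shows "cnt A u * cnt B v - cnt B u * cnt A v = 1"
  using assms by (induction rule: christoffel_triple.induct) (auto simp: algebra_simps)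

lemma christoffel_triple_unique:
  assumes 1: "christoffel_triple u m v" and 2: "christoffel_triple u' m v'"
  shows "u = u' \<and> v = v'"
proof -
  have m: "m = u @ v" "m = u' @ v'"
    using assms christoffel_triple_middle by blast+
  have len: "length u > 0" "length v > 0" "length u' > 0" "length v' > 0"
    using assms christoffel_triple_nonempty by blast+
  define p q where "p = cnt A m" and "q = cnt B m"
  have p: "p = cnt A u + cnt A v" "p = cnt A u' + cnt A v'"
    unfolding p_def by (simp add: m(1), simp add: m(2))
  have q: "q = cnt B u + cnt B v" "q = cnt B u' + cnt B v'"
    unfolding q_def by (simp add: m(1), simp add: m(2))
  have d: "cnt A u * q - cnt B u * p = 1"
    using christoffel_triple_det[OF 1] by (simp add: p(1) q(1) algebra_simps)
  have d': "cnt A u' * q - cnt B u' * p = 1"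
    using christoffel_triple_det[OF 2] by (simp add: p(2) q(2) algebra_simps)
  define da db where "da = cnt A u - cnt A u'" and "db = cnt B u - cnt B u'"
  have e: "da * q = db * p"
    using d d' by (simp add: da_def db_def algebra_simps)
  define j where "j = cnt A u * db - cnt B u * da"
  have dj: "da = j * p" 
  proof -
    have "da = da * (cnt A u * q - cnt B u * p)" using d by simp
    also have "\<dots> = cnt A u * (da * q) - da * cnt B u * p" by (simp add: algebra_simps)
    also have "\<dots> = j * p" unfolding e j_def by (simp add: algebra_simps)
    finally show ?thesis .
  qed
  have dbj: "db = j * q"
  proof -
    have "db = db * (cnt A u * q - cnt B u * p)" using d by simp
    also have "\<dots> = cnt A u * db * q - cnt B u * (db * p)" by (simp add: algebra_simps)
    also have "\<dots> = j * q" unfolding e[symmetric] j_def by (simp add: algebra_simps)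
    finally show ?thesis .
  qed
  have pq: "p + q = int (length m)" unfolding p_def q_def by (rule cnt_length)
  have "int (length u) - int (length u') = da + db"
    unfolding da_def db_def using cnt_length[of u] cnt_length[of u'] by simp
  then have lj: "int (length u) - int (length u') = j * int (length m)"
    using dj dbj pq by (simp add: algebra_simps flip: pq)
  have l: "length m = length u + length v" "length m = length u' + length v'"
    by (simp add: m(1), simp add: m(2))
  have "\<bar>j * int (length m)\<bar> < int (length m)"
    using lj l len by linarith
  then have "\<bar>j\<bar> * int (length m) < 1 * int (length m)"
    by (simp add: abs_mult)
  then have "\<bar>j\<bar> < 1"
    using mult_less_cancel_right_pos[of "int (length m)"] l len by simp
  then have "length u = length u'" using lj by simp
  then show ?thesis using m by simp
qed

lemma christoffel_triple_left_inject:
  assumes "christoffel_triple w (w @ w') w'" "christoffel_triple v (v @ v') v'"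
    and "w @ w @ w' = v @ v @ v'"
  shows "w = v \<and> w' = v'"
  using christoffel_triple_unique[OF left[OF assms(1)], of v "v @ v'"] left[OF assms(2)] assms(3)
  by simp

lemma christoffel_triple_right_inject:
  assumes "christoffel_triple w (w @ w') w'" "christoffel_triple v (v @ v') v'"
    and "w @ w' @ w' = v @ v' @ v'"
  shows "w = v \<and> w' = v'"
  using christoffel_triple_unique[OF right[OF assms(1)], of "v @ v'" v'] right[OF assms(2)] assms(3)
  by simp

lemma christoffel_triple_left_neq_right:
  assumes "christoffel_triple w (w @ w') w'" "christoffel_triple v (v @ v') v'"
  shows "w @ w @ w' \<noteq> v @ v' @ v'"
proof
  assume "w @ w @ w' = v @ v' @ v'"
  then have "w = v @ v' \<and> w @ w' = v'"
    using christoffel_triple_unique[OF left[OF assms(1)], of "v @ v'" v'] right[OF assms(2)]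
    by simp
  then have "length w = length v + length v'" "length w + length w' = length v'"
    by (metis length_append)+
  then show False
    using christoffel_triple_nonempty[OF assms(2)] by simp
qed

lemma christoffel_triple_child_long:
  assumes "christoffel_triple w (w @ w') w'"
  shows "length (w @ w @ w') \<ge> 3" "length (w @ w' @ w') \<ge> 3"
proof -
  have "length w > 0" "length w' > 0"
    using christoffel_triple_nonempty[OF assms] by auto
  then show "length (w @ w @ w') \<ge> 3" "length (w @ w' @ w') \<ge> 3"
    by (simp_all, linarith+)
qed

lemma short_words:
  "\<not> length [A] \<ge> 3" "\<not> length [A, B] \<ge> 3" "\<not> length [B] \<ge> 3"
  by simp_all

lemma castling_unique:
  assumes "castling w p" "castling w p'"
  shows "p = p'"
  using assms
proof (induction arbitrary: p' rule: castling.induct)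
  case 1
  then show ?case
  proof (cases rule: castling.cases)
    case (4 v v' p1 q1 r1)
    with christoffel_triple_child_long(1)[OF 4(3)] show ?thesis
      by (metis short_words(1))
  next
    case (5 v v' p1 q1 r1)
    with christoffel_triple_child_long(2)[OF 5(3)] show ?thesis
      by (metis short_words(1))
  qed simp_all
next
  case 2
  then show ?case
  proof (cases rule: castling.cases)
    case (4 v v' p1 q1 r1)
    with christoffel_triple_child_long(1)[OF 4(3)] show ?thesis
      by (metis short_words(2))
  next
    case (5 v v' p1 q1 r1)
    with christoffel_triple_child_long(2)[OF 5(3)] show ?thesis
      by (metis short_words(2))
  qed simp_all
next
  case 3
  then show ?case
  proof (cases rule: castling.cases)
    case (4 v v' p1 q1 r1)
    with christoffel_triple_child_long(1)[OF 4(3)] show ?thesis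
      by (metis short_words(3))
  next
    case (5 v v' p1 q1 r1)
    with christoffel_triple_child_long(2)[OF 5(3)] show ?thesis
      by (metis short_words(3))
  qed simp_all
next
  case (4 w w' p q r)
  from 4(8) show ?case
  proof (cases rule: castling.cases)
    case (4 v v' p1 q1 r1)
    then have "w = v \<and> w' = v'"
      using christoffel_triple_left_inject \<open>christoffel_triple w (w @ w') w'\<close> by blast
    with 4 "4.IH" show ?thesis by metis
  next
    case (5 v v' p1 q1 r1)
    then show ?thesis
      using christoffel_triple_left_neq_right \<open>christoffel_triple w (w @ w') w'\<close> by blast
  qed (use christoffel_triple_child_long(1)[OF 4(1)] in simp_all)
next
  case (5 w w' p q r)
  from 5(8) show ?case
  proof (cases rule: castling.cases)
    case (4 v v' p1 q1 r1)
    then show ?thesis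
      using christoffel_triple_left_neq_right \<open>christoffel_triple w (w @ w') w'\<close> by metis
  next
    case (5 v v' p1 q1 r1)
    then have "w = v \<and> w' = v'"
      using christoffel_triple_right_inject \<open>christoffel_triple w (w @ w') w'\<close> by blast
    with 5 "5.IH" show ?thesis by metis
  qed (use christoffel_triple_child_long(2)[OF 5(1)] in simp_all)
qed

lemma castling_exists:
  assumes "christoffel_triple u m v"
  shows "\<exists>p q r. castling u p \<and> castling m q \<and> castling v r"
  using assms by (induction rule: christoffel_triple.induct) (blast intro: castling.intros)+

lemma castling_poly_eqI: "castling w p \<Longrightarrow> castling_poly w = p"
  unfolding castling_poly_def using castling_unique by blast

lemma castling_castling_poly:
  assumes "christoffel_triple u m v"
  shows "castling u (castling_poly u)" "castling m (castling_poly m)" "castling v (castling_poly v)"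
  using castling_exists[OF assms] castling_poly_eqI by auto

text \<open>The defining recursion of the castling Markov polynomials.\<close>

lemma castling_poly_base:
  "castling_poly [A] = 1" "castling_poly [A, B] = t ^ 2 - t - 1" "castling_poly [B] = t - 1"
  by (rule castling_poly_eqI, rule castling.intros)+

lemma castling_poly_rec:
  assumes "christoffel_triple w (w @ w') w'"
  shows "castling_poly (w @ w @ w') = t * castling_poly w * castling_poly (w @ w') - castling_poly w'"
    and "castling_poly (w @ w' @ w') = t * castling_poly (w @ w') * castling_poly w' - castling_poly w"
  using castling_castling_poly[OF assms] assms by (blast intro: castling_poly_eqI castling.intros)+

end

(* Each step of the tree is a Vieta jump: as a quadratic in z, the equation has roots with
   sum t x y, so replacing z by t x y - z (or x by t y z - x) preserves it. *)
theory Submission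
  imports Defs
begin

text \<open>Induction along the tree (\<open>castling_poly_markov\<close>): the root is a direct
  expansion, and each child keeps two polynomials of its parent and swaps the third for the other
  root of the equation, seen as a quadratic in it (\<open>vieta_jump\<close>).\<close>

lemma vieta_jump:
  fixes s c x y z :: "'a::comm_ring_1"
  assumes "x ^ 2 + y ^ 2 + z ^ 2 + c = s * x * y * z"
  shows "x ^ 2 + y ^ 2 + (s * x * y - z) ^ 2 + c = s * x * y * (s * x * y - z)"
proof -
  have "x ^ 2 + y ^ 2 + (s * x * y - z) ^ 2 + c
    = (x ^ 2 + y ^ 2 + z ^ 2 + c) + s * x * y * (s * x * y - 2 * z)"
    by (simp add: power2_eq_square algebra_simps)
  also have "\<dots> = s * x * y * (s * x * y - z)"
    unfolding assms by (simp add: algebra_simps)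
  finally show ?thesis .
qed

lemma castling_poly_markov:
  assumes "christoffel_triple u m v"
  shows "castling_poly u ^ 2 + castling_poly m ^ 2 + castling_poly v ^ 2 + (t - 3)
    = t * castling_poly u * castling_poly m * castling_poly v"
  using assms
proof (induction rule: christoffel_triple.induct)
  case base
  \<comment> \<open>A generic \<open>s\<close> keeps \<open>simp\<close> from computing with the
    literal \<open>[:0, 1:]\<close>.\<close>
  have "1 ^ 2 + (s ^ 2 - s - 1) ^ 2 + (s - 1) ^ 2 + (s - 3) = s * 1 * (s ^ 2 - s - 1) * (s - 1)"
    for s :: "int poly"
    by (simp add: power2_eq_square algebra_simps)
  then show ?case
    unfolding castling_poly_base .
next
  case (left w w')
  from vieta_jump[OF left.IH] show ?case
    unfolding castling_poly_rec(1)[OF left.hyps] by (simp only: ac_simps)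
next
  case (right w w')
  \<comment> \<open>The right child replaces the first entry, so the symmetric equation is rotated
    to put it in the last slot, which \<open>vieta_jump\<close> alters.\<close>
  from right.IH
  have "castling_poly (w @ w') ^ 2 + castling_poly w' ^ 2 + castling_poly w ^ 2 + (t - 3)
    = t * castling_poly (w @ w') * castling_poly w' * castling_poly w"
    by (simp only: ac_simps)
  from vieta_jump[OF this] show ?case
    unfolding castling_poly_rec(2)[OF right.hyps] by (simp only: ac_simps)
qed

theorem theorem3p6:
  fixes w w' :: word and x y z :: "int poly"
  assumes "christoffel_triple w (w @ w') w'"
    and "(x, y, z) = (castling_poly w, castling_poly (w @ w'), castling_poly w')"
  shows "x ^ 2 + y ^ 2 + z ^ 2 + (t - 3) = t * x * y * z"
  using castling_poly_markov[OF assms(1)] assms(2) by simp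

end
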